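(* Let $n\ge1$, let $\Delta^+$ be the positive roots of type $A_n$ with the root order, let $\mathfrak X$ be the reverse operator on $\mathrm{AN}(\Delta^+)$ and $\Gamma\mapsto\Gamma^*$ the duality on $\mathrm{AN}(\Delta^+)$. Then for every $\Gamma\in\mathrm{AN}(\Delta^+)$ one has $\mathfrak X(\Gamma)^*=\mathfrak X^{-1}(\Gamma^* )$.
   Context: Write $\Delta^+=\{\varepsilon_i-\varepsilon_{j+1}\mid 1\le i\le j\le n\}$ with simple roots $\alpha_i=\varepsilon_i-\varepsilon_{i+1}$, and denote the root $\alpha_i+\dots+\alpha_j=\varepsilon_i-\varepsilon_{j+1}$ by $(i,j)$. The root order is $x\preccurlyeq y$ iff $y-x$ is a non-negative integral combination of simple roots. An antichain is a set of mutually incomparable roots (including $\varnothing$); $\mathrm{AN}(\Delta^+)$ is the set of antichains. For $\Gamma$ an antichain, $\mathcal I(\Gamma)=\{x\in\Delta^+\mid\exists\gamma\in\Gamma,\ \gamma\preccurlyeq x\}$; for a subset $S$, $S_{max}$ is its set of maximal elements. The reverse operator is $\mathfrak X(\Gamma)=(\Delta^+\setminus\mathcal I(\Gamma))_{max}$; it is a bijection. A set $\Gamma=\{(i_1,j_1),\dots,(i_k,j_k)\}$ with $i_1<\dots<i_k$ is an antichain iff $j_1<\dots<j_k$ and $i_s\le j_s$ for all $s$; thus an antichain is encoded by the pair of strictly increasing sequences $\mathbf i=(i_1,\dots,i_k)$, $\mathbf j=(j_1,\dots,j_k)$ in $[n]=\{1,\dots,n\}$ with $\mathbf i\le\mathbf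 j$ componentwise. Duality: $\Gamma^*$ is the antichain whose sequences are $\mathbf i^*=[n]\setminus\mathbf j$ and $\mathbf j^*=[n]\setminus\mathbf i$ (each listed increasingly and paired in order); this is again an antichain and $\ast$ is an involution of $\mathrm{AN}(\Delta^+)$. *)

theory Defs
  imports Main
begin

(* The ambient lattice is realised as functions nat => int; for type A_n only the
   coordinates 1, ..., n+1 are used. *)

definition eps :: "nat \<Rightarrow> nat \<Rightarrow> int" where
  "eps i = (\<lambda>m. if m = i then 1 else 0)"

definition ij_root :: "nat \<Rightarrow> nat \<Rightarrow> nat \<Rightarrow> int" where
  "ij_root i j = (\<lambda>m. eps i m - eps (j + 1) m)"

definition simple_root :: "nat \<Rightarrow> nat \<Rightarrow> int" where
  "simple_root i = (\<lambda>m. eps i m - eps (i + 1) m)"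

definition pos_roots :: "nat \<Rightarrow> (nat \<Rightarrow> int) set" where
  "pos_roots n = {ij_root i j | i j. 1 \<le> i \<and> i \<le> j \<and> j \<le> n}"

definition root_le :: "nat \<Rightarrow> (nat \<Rightarrow> int) \<Rightarrow> (nat \<Rightarrow> int) \<Rightarrow> bool" where
  "root_le n x y \<longleftrightarrow>
     (\<exists>c :: nat \<Rightarrow> nat. \<forall>m. y m - x m = (\<Sum>k = 1..n. int (c k) * simple_root k m))"

definition AN :: "nat \<Rightarrow> (nat \<Rightarrow> int) set set" where
  "AN n = {\<Gamma>. \<Gamma> \<subseteq> pos_roots n \<and> (\<forall>x\<in>\<Gamma>. \<forall>y\<in>\<Gamma>. x \<noteq> y \<longrightarrow> \<not> root_le n x y)}"

definition upper_ideal :: "nat \<Rightarrow> (nat \<Rightarrow> int) set \<Rightarrow> (nat \<Rightarrow> int) set" where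
  "upper_ideal n \<Gamma> = {x \<in> pos_roots n. \<exists>\<gamma>\<in>\<Gamma>. root_le n \<gamma> x}"

definition max_elems :: "nat \<Rightarrow> (nat \<Rightarrow> int) set \<Rightarrow> (nat \<Rightarrow> int) set" where
  "max_elems n S = {x \<in> S. \<forall>y\<in>S. root_le n x y \<longrightarrow> y = x}"

definition reverse_op :: "nat \<Rightarrow> (nat \<Rightarrow> int) set \<Rightarrow> (nat \<Rightarrow> int) set" where
  "reverse_op n \<Gamma> = max_elems n (pos_roots n - upper_ideal n \<Gamma>)"

(* The entries of the sequences i = (i_1 < ... < i_k) and j = (j_1 < ... < j_k)
   that encode an antichain. *)

definition i_entries :: "nat \<Rightarrow> (nat \<Rightarrow> int) set \<Rightarrow> nat set" where
  "i_entries n \<Gamma> = {i. \<exists>j. 1 \<le> i \<and> i \<le> j \<and> j \<le> n \<and> ij_root i j \<in> \<Gamma>}"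

definition j_entries :: "nat \<Rightarrow> (nat \<Rightarrow> int) set \<Rightarrow> nat set" where
  "j_entries n \<Gamma> = {j. \<exists>i. 1 \<le> i \<and> i \<le> j \<and> j \<le> n \<and> ij_root i j \<in> \<Gamma>}"

(* For an antichain both complements have n - k elements, so map2 does not truncate. *)

definition dual_AN :: "nat \<Rightarrow> (nat \<Rightarrow> int) set \<Rightarrow> (nat \<Rightarrow> int) set" where
  "dual_AN n \<Gamma> = set (map2 ij_root
     (sorted_list_of_set ({1..n} - j_entries n \<Gamma>))
     (sorted_list_of_set ({1..n} - i_entries n \<Gamma>)))"


(* The reverse operator is a bijection of AN n, so that inv_into (AN n) (reverse_op n)
   is its genuine inverse there. *)

definition height :: "nat \<Rightarrow> (nat \<Rightarrow> int) \<Rightarrow> int" where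
  "height n x = (\<Sum>m = 1..n + 1. - int m * x m)"

lemma height_simple_root:
  assumes "k \<in> {1..n}"
  shows "height n (simple_root k) = 1"
proof -
  have "height n (simple_root k) =
      (\<Sum>m = 1..n + 1. (if m = k then - int m else 0) + (if m = k + 1 then int m else 0))"
    unfolding height_def simple_root_def eps_def by (intro sum.cong) auto
  also have "\<dots> = 1"
    using assms unfolding sum.distrib by (simp add: sum.delta)
  finally show ?thesis .
qed

lemma height_diff:
  assumes "\<And>m. y m - x m = (\<Sum>k = 1..n. int (c k) * simple_root k m)"
  shows "height n y - height n x = (\<Sum>k = 1..n. int (c k))"
proof -
  have "height n y - height n x = (\<Sum>m = 1..n + 1. - int m * (y m - x m))"
    unfolding height_def by (simp add: sum_subtractf[symmetric] algebra_simps)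
  also have "\<dots> = (\<Sum>m = 1..n + 1. \<Sum>k = 1..n. int (c k) * (- int m * simple_root k m))"
    unfolding assms sum_distrib_left by (intro sum.cong) auto
  also have "\<dots> = (\<Sum>k = 1..n. \<Sum>m = 1..n + 1. int (c k) * (- int m * simple_root k m))"
    by (rule sum.swap)
  also have "\<dots> = (\<Sum>k = 1..n. int (c k) * height n (simple_root k))"
    unfolding height_def sum_distrib_left ..
  also have "\<dots> = (\<Sum>k = 1..n. int (c k))"
    by (intro sum.cong) (auto simp: height_simple_root)
  finally show ?thesis .
qed

lemma root_le_refl: "root_le n x x"
  unfolding root_le_def by (rule exI[of _ "\<lambda>_. 0"]) simp

lemma root_le_trans:
  assumes "root_le n x y" "root_le n y z"
  shows "root_le n x z"
proof -
  obtain c where c: "\<And>m. y m - x m = (\<Sum>k = 1..n. int (c k) * simple_root k m)"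
    using assms(1) unfolding root_le_def by blast
  obtain d where d: "\<And>m. z m - y m = (\<Sum>k = 1..n. int (d k) * simple_root k m)"
    using assms(2) unfolding root_le_def by blast
  have "z m - x m = (\<Sum>k = 1..n. int (c k + d k) * simple_root k m)" for m
    using c[of m] d[of m] by (simp add: distrib_right sum.distrib)
  then show ?thesis unfolding root_le_def by (intro exI[of _ "\<lambda>k. c k + d k"]) simp
qed

lemma root_le_height:
  assumes "root_le n x y" "x \<noteq> y"
  shows "height n x < height n y"
proof (rule ccontr)
  assume *: "\<not> height n x < height n y"
  obtain c where c: "\<And>m. y m - x m = (\<Sum>k = 1..n. int (c k) * simple_root k m)"
    using assms(1) unfolding root_le_def by blast
  have "(\<Sum>k = 1..n. int (c k)) \<ge> 0" by (intro sum_nonneg) simp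
  with height_diff[OF c] * have "(\<Sum>k = 1..n. int (c k)) = 0" by linarith
  then have "\<forall>k\<in>{1..n}. int (c k) = 0"
    by (subst (asm) sum_nonneg_eq_0_iff) auto
  then have "y m - x m = 0" for m unfolding c by simp
  then have "x = y" by (intro ext) simp
  with assms(2) show False by simp
qed

lemma root_le_antisym: "root_le n x y \<Longrightarrow> root_le n y x \<Longrightarrow> x = y"
  using root_le_height[of n x y] root_le_height[of n y x] by (cases "x = y") auto

lemma finite_pos_roots: "finite (pos_roots n)"
proof (rule finite_subset)
  show "pos_roots n \<subseteq> case_prod ij_root ` ({1..n} \<times> {1..n})"
    unfolding pos_roots_def by force
qed simp

definition min_elems :: "nat \<Rightarrow> (nat \<Rightarrow> int) set \<Rightarrow> (nat \<Rightarrow> int) set" where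
  "min_elems n S = {x \<in> S. \<forall>y\<in>S. root_le n y x \<longrightarrow> y = x}"

definition lower_ideal :: "nat \<Rightarrow> (nat \<Rightarrow> int) set \<Rightarrow> (nat \<Rightarrow> int) set" where
  "lower_ideal n \<Gamma> = {x \<in> pos_roots n. \<exists>\<gamma>\<in>\<Gamma>. root_le n x \<gamma>}"

lemma below_max:
  assumes "S \<subseteq> pos_roots n" "x \<in> S"
  shows "\<exists>y\<in>max_elems n S. root_le n x y"
proof -
  let ?T = "{y \<in> S. root_le n x y}"
  have fin: "finite ?T" using assms(1) finite_pos_roots[of n] finite_subset by fastforce
  have x: "x \<in> ?T" using assms(2) root_le_refl by simp
  obtain y where y: "y \<in> ?T" "height n y = Max (height n ` ?T)"
    using Max_in[of "height n ` ?T"] fin x by fastforce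
  have "z = y" if z: "z \<in> S" "root_le n y z" for z
  proof (rule ccontr)
    assume "z \<noteq> y"
    then have "height n y < height n z" using z root_le_height by blast
    moreover have "z \<in> ?T" using z y(1) root_le_trans by blast
    then have "height n z \<le> Max (height n ` ?T)" using fin by (intro Max_ge) auto
    ultimately show False using y(2) by linarith
  qed
  then show ?thesis using y(1) unfolding max_elems_def by blast
qed

lemma above_min:
  assumes "S \<subseteq> pos_roots n" "x \<in> S"
  shows "\<exists>y\<in>min_elems n S. root_le n y x"
proof -
  let ?T = "{y \<in> S. root_le n y x}"
  have fin: "finite ?T" using assms(1) finite_pos_roots[of n] finite_subset by fastforce
  have x: "x \<in> ?T" using assms(2) root_le_refl by simp
  obtain y where y: "y \<in> ?T" "height n y = Min (height n ` ?T)"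
    using Min_in[of "height n ` ?T"] fin x by fastforce
  have "z = y" if z: "z \<in> S" "root_le n z y" for z
  proof (rule ccontr)
    assume "z \<noteq> y"
    then have "height n z < height n y" using z root_le_height by blast
    moreover have "z \<in> ?T" using z y(1) root_le_trans by blast
    then have "Min (height n ` ?T) \<le> height n z" using fin by (intro Min_le) auto
    ultimately show False using y(2) by linarith
  qed
  then show ?thesis using y(1) unfolding min_elems_def by blast
qed

lemma max_elems_AN: "S \<subseteq> pos_roots n \<Longrightarrow> max_elems n S \<in> AN n"
  unfolding max_elems_def AN_def by auto

lemma min_elems_AN: "S \<subseteq> pos_roots n \<Longrightarrow> min_elems n S \<in> AN n"
  unfolding min_elems_def AN_def by auto

lemma max_lower_ideal:
  assumes "\<Gamma> \<in> AN n" shows "max_elems n (lower_ideal n \<Gamma>) = \<Gamma>"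
proof
  have sub: "\<Gamma> \<subseteq> lower_ideal n \<Gamma>"
    using assms root_le_refl unfolding AN_def lower_ideal_def by blast
  show "max_elems n (lower_ideal n \<Gamma>) \<subseteq> \<Gamma>"
  proof
    fix x assume x: "x \<in> max_elems n (lower_ideal n \<Gamma>)"
    then obtain g where "g \<in> \<Gamma>" "root_le n x g"
      unfolding max_elems_def lower_ideal_def by blast
    then show "x \<in> \<Gamma>" using x sub unfolding max_elems_def by auto
  qed
  show "\<Gamma> \<subseteq> max_elems n (lower_ideal n \<Gamma>)"
  proof
    fix x assume x: "x \<in> \<Gamma>"
    have "y = x" if y: "y \<in> lower_ideal n \<Gamma>" "root_le n x y" for y
    proof -
      obtain g where g: "g \<in> \<Gamma>" "root_le n y g" using y unfolding lower_ideal_def by blast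
      have "root_le n x g" using y g root_le_trans by blast
      then have "x = g" using x g assms unfolding AN_def by blast
      then show ?thesis using y g root_le_antisym by blast
    qed
    then show "x \<in> max_elems n (lower_ideal n \<Gamma>)"
      using x sub unfolding max_elems_def by blast
  qed
qed

lemma min_upper_ideal:
  assumes "\<Gamma> \<in> AN n" shows "min_elems n (upper_ideal n \<Gamma>) = \<Gamma>"
proof
  have sub: "\<Gamma> \<subseteq> upper_ideal n \<Gamma>"
    using assms root_le_refl unfolding AN_def upper_ideal_def by blast
  show "min_elems n (upper_ideal n \<Gamma>) \<subseteq> \<Gamma>"
  proof
    fix x assume x: "x \<in> min_elems n (upper_ideal n \<Gamma>)"
    then obtain g where "g \<in> \<Gamma>" "root_le n g x"
      unfolding min_elems_def upper_ideal_def by blast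
    then show "x \<in> \<Gamma>" using x sub unfolding min_elems_def by auto
  qed
  show "\<Gamma> \<subseteq> min_elems n (upper_ideal n \<Gamma>)"
  proof
    fix x assume x: "x \<in> \<Gamma>"
    have "y = x" if y: "y \<in> upper_ideal n \<Gamma>" "root_le n y x" for y
    proof -
      obtain g where g: "g \<in> \<Gamma>" "root_le n g y" using y unfolding upper_ideal_def by blast
      have "root_le n g x" using y g root_le_trans by blast
      then have "g = x" using x g assms unfolding AN_def by blast
      then show ?thesis using y g root_le_antisym by blast
    qed
    then show "x \<in> min_elems n (upper_ideal n \<Gamma>)"
      using x sub unfolding min_elems_def by blast
  qed
qed

lemma lower_ideal_reverse_op:
  "lower_ideal n (reverse_op n \<Gamma>) = pos_roots n - upper_ideal n \<Gamma>"
proof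
  show "lower_ideal n (reverse_op n \<Gamma>) \<subseteq> pos_roots n - upper_ideal n \<Gamma>"
    unfolding lower_ideal_def reverse_op_def max_elems_def upper_ideal_def
    using root_le_trans by blast
  show "pos_roots n - upper_ideal n \<Gamma> \<subseteq> lower_ideal n (reverse_op n \<Gamma>)"
    using below_max[of "pos_roots n - upper_ideal n \<Gamma>" n]
    unfolding lower_ideal_def reverse_op_def by blast
qed

lemma upper_ideal_min_elems:
  "upper_ideal n (min_elems n (pos_roots n - lower_ideal n \<Gamma>)) = pos_roots n - lower_ideal n \<Gamma>"
proof
  show "upper_ideal n (min_elems n (pos_roots n - lower_ideal n \<Gamma>))
      \<subseteq> pos_roots n - lower_ideal n \<Gamma>"
    unfolding lower_ideal_def min_elems_def upper_ideal_def
    using root_le_trans by blast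
  show "pos_roots n - lower_ideal n \<Gamma>
      \<subseteq> upper_ideal n (min_elems n (pos_roots n - lower_ideal n \<Gamma>))"
    using above_min[of "pos_roots n - lower_ideal n \<Gamma>" n]
    unfolding upper_ideal_def by blast
qed

lemma reverse_op_bij: "bij_betw (reverse_op n) (AN n) (AN n)"
proof (rule bij_betw_byWitness[where f' = "\<lambda>\<Gamma>. min_elems n (pos_roots n - lower_ideal n \<Gamma>)"])
  have "pos_roots n - (pos_roots n - upper_ideal n \<Gamma>) = upper_ideal n \<Gamma>" for \<Gamma>
    unfolding upper_ideal_def by blast
  then show "\<forall>\<Gamma>\<in>AN n. min_elems n (pos_roots n - lower_ideal n (reverse_op n \<Gamma>)) = \<Gamma>"
    by (simp add: lower_ideal_reverse_op min_upper_ideal)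
  have "pos_roots n - (pos_roots n - lower_ideal n \<Gamma>) = lower_ideal n \<Gamma>" for \<Gamma>
    unfolding lower_ideal_def by blast
  then show "\<forall>\<Gamma>\<in>AN n. reverse_op n (min_elems n (pos_roots n - lower_ideal n \<Gamma>)) = \<Gamma>"
    by (simp add: reverse_op_def upper_ideal_min_elems max_lower_ideal)
  show "reverse_op n ` AN n \<subseteq> AN n"
    unfolding reverse_op_def by (auto intro!: max_elems_AN)
  show "(\<lambda>\<Gamma>. min_elems n (pos_roots n - lower_ideal n \<Gamma>)) ` AN n \<subseteq> AN n"
    by (auto intro!: min_elems_AN)
qed

end

(* A root (i, j) is the interval [i, j], and the root order is inclusion.  Write X for the
   reverse operator, I and J for the sets of left and right end points of \<Gamma>.
   The left end points of X(\<Gamma>) are those a with a = 1 or a - 1 \<in> I for which the simple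
   root \<alpha>_a is not in \<Gamma>; symmetrically, the right ones are those b with b = n or b + 1 \<in> J
   for which \<alpha>_b is not in \<Gamma>.  Moreover \<alpha>_b belongs to the dual of \<Gamma> iff no interval of \<Gamma>
   contains b.  Hence \<alpha>_b belongs to the dual of X(\<Gamma>) iff it lies in the upper ideal of \<Gamma>,
   that is, iff \<alpha>_b is in \<Gamma>.  It follows that X applied to the dual of X(\<Gamma>) has the same
   end points as the dual of \<Gamma>, and an antichain is determined by its end points. *)

theory Submission
  imports Defs
begin

subsection \<open>Roots as intervals\<close>

lemma ij_root_in_pos_roots_iff:
  "ij_root i j \<in> pos_roots n \<longleftrightarrow> 1 \<le> i \<and> i \<le> j \<and> j \<le> n"
proof
  assume "ij_root i j \<in> pos_roots n"
  then obtain a b where ab: "ij_root i j = ij_root a b" "1 \<le> a" "a \<le> b" "b \<le> n"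
    unfolding pos_roots_def by blast
  \<comment> \<open>The root \<open>ij_root a b\<close> is 1 at \<open>a\<close> and -1 at
    \<open>Suc b\<close>; this forces \<open>i = a\<close> and \<open>j = b\<close>, with nothing
    known about \<open>i\<close> and \<open>j\<close> beforehand.\<close>
  from fun_cong[OF ab(1), of a] fun_cong[OF ab(1), of "Suc b"] ab(2-)
  show "1 \<le> i \<and> i \<le> j \<and> j \<le> n"
    unfolding ij_root_def eps_def by (auto split: if_splits)
qed (auto simp: pos_roots_def)

lemma simple_root_eq: "simple_root k = ij_root k k"
  by (simp add: simple_root_def ij_root_def)

text \<open>The 1 at \<open>i\<close> enters the sum once \<open>p\<close> reaches \<open>i\<close>,
  and the -1 at \<open>j + 1\<close> cancels it beyond \<open>j\<close>. Summing up to
  \<open>p\<close> thus reads off the coefficient of \<alpha>_p.\<close>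

lemma sum_ij_root:
  assumes "1 \<le> i" "i \<le> j"
  shows "(\<Sum>m = Suc 0..p. ij_root i j m) = of_bool (i \<le> p \<and> p \<le> j)"
  using assms unfolding ij_root_def eps_def sum_subtractf by (auto simp: sum.delta')

lemma sum_simple_root_eq:
  assumes "1 \<le> i" "i \<le> j" "j \<le> n"
  shows "(\<Sum>k = 1..n. of_bool (i \<le> k \<and> k \<le> j) * simple_root k m) = ij_root i j m"
proof -
  have "(\<Sum>k = 1..n. of_bool (i \<le> k \<and> k \<le> j) * simple_root k m) = (\<Sum>k = i..j. simple_root k m)"
    using assms by (intro sum.mono_neutral_cong_right) auto
  \<comment> \<open>Written as differences of \<open>- eps k m\<close> at successive
    \<open>k\<close>, so that the sum telescopes.\<close>
  also have "\<dots> = (\<Sum>k = i..j. - eps (Suc k) m - - eps k m)"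
    by (simp add: simple_root_def)
  also have "\<dots> = ij_root i j m"
    using assms sum_Suc_diff[of i j "\<lambda>k. - eps k m"] by (simp add: ij_root_def)
  finally show ?thesis .
qed

lemma root_le_ij_root_iff:
  assumes "1 \<le> i" "i \<le> j" "j \<le> n" "1 \<le> a" "a \<le> b" "b \<le> n"
  shows "root_le n (ij_root i j) (ij_root a b) \<longleftrightarrow> a \<le> i \<and> j \<le> b"
proof
  assume "root_le n (ij_root i j) (ij_root a b)"
  then obtain c where
    c: "\<And>m. ij_root a b m - ij_root i j m = (\<Sum>k = 1..n. int (c k) * simple_root k m)"
    unfolding root_le_def by blast
  \<comment> \<open>Partial sums up to \<open>p\<close> isolate the coefficient of \<alpha>_p as a
    difference of two indicators. Since it is non-negative at \<open>i\<close> and at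
    \<open>j\<close>, both lie in [a, b].\<close>
  have "of_bool (a \<le> p \<and> p \<le> b) - of_bool (i \<le> p \<and> p \<le> j) = int (c p)" if "p \<in> {1..n}" for p
  proof -
    have "of_bool (a \<le> p \<and> p \<le> b) - of_bool (i \<le> p \<and> p \<le> j)
        = (\<Sum>m = 1..p. ij_root a b m - ij_root i j m)"
      using assms by (simp add: sum_subtractf sum_ij_root)
    also have "\<dots> = (\<Sum>k = 1..n. \<Sum>m = 1..p. int (c k) * ij_root k k m)"
      unfolding c simple_root_eq by (rule sum.swap)
    also have "\<dots> = (\<Sum>k = 1..n. int (c k) * of_bool (k = p))"
      by (intro sum.cong) (auto simp: sum_distrib_left[symmetric] sum_ij_root)
    also have "\<dots> = int (c p)" using that by simp
    finally show ?thesis .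
  qed
  from this[of i] this[of j] assms show "a \<le> i \<and> j \<le> b"
    by (auto simp: of_bool_def split: if_splits)
next
  assume *: "a \<le> i \<and> j \<le> b"
  \<comment> \<open>These are the coefficients forced by the other direction; inclusion makes them
    non-negative, so \<open>nat\<close> loses nothing.\<close>
  let ?c = "\<lambda>k. of_bool (a \<le> k \<and> k \<le> b) - of_bool (i \<le> k \<and> k \<le> j) :: int"
  have "int (nat (?c k)) = ?c k" for k
    using * by auto
  then show "root_le n (ij_root i j) (ij_root a b)"
    using assms unfolding root_le_def
    by (intro exI[of _ "\<lambda>k. nat (?c k)"])
      (simp only: left_diff_distrib sum_subtractf sum_simple_root_eq simp_thms)
qed

section \<open>Antichains and their ideals in terms of intervals\<close>

lemma AN_bounds:
  assumes "\<Gamma> \<in> AN n" "ij_root i j \<in> \<Gamma>"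
  shows "1 \<le> i" "i \<le> j" "j \<le> n"
  using assms ij_root_in_pos_roots_iff[of i j n] unfolding AN_def by blast+

lemma AN_is_ij_root:
  assumes "\<Gamma> \<in> AN n" "x \<in> \<Gamma>"
  obtains i j where "x = ij_root i j"
  using assms unfolding AN_def pos_roots_def by blast

lemma ij_root_inject:
  assumes "i \<le> j" "a \<le> b"
  shows "ij_root i j = ij_root a b \<longleftrightarrow> i = a \<and> j = b"
proof
  assume eq: "ij_root i j = ij_root a b"
  from fun_cong[OF eq, of i] fun_cong[OF eq, of "Suc j"] assms
  show "i = a \<and> j = b" unfolding ij_root_def eps_def by (auto split: if_splits)
qed simp

lemma AN_nested_eq:
  assumes "\<Gamma> \<in> AN n" "ij_root i j \<in> \<Gamma>" "ij_root a b \<in> \<Gamma>" "a \<le> i" "j \<le> b"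
  shows "a = i \<and> b = j"
proof -
  note * = AN_bounds[OF assms(1,2)] AN_bounds[OF assms(1,3)]
  have "root_le n (ij_root i j) (ij_root a b)"
    using * assms(4,5) root_le_ij_root_iff by blast
  then have "ij_root i j = ij_root a b" using assms(1-3) unfolding AN_def by blast
  with * show ?thesis using ij_root_inject by blast
qed

text \<open>If the left ends and the right ends compared differently, one interval would contain the
  other.\<close>

lemma AN_less_iff:
  assumes "\<Gamma> \<in> AN n" "ij_root i j \<in> \<Gamma>" "ij_root a b \<in> \<Gamma>"
  shows "i < a \<longleftrightarrow> j < b"
  using AN_nested_eq[OF assms(1,2,3)] AN_nested_eq[OF assms(1,3,2)] by linarith

text \<open>Two nested intervals whose ends are ordered alike coincide. This is the criterion
  applied to the dual, whose ends are matched in increasing order.\<close>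

lemma AN_I:
  assumes "\<And>x. x \<in> \<Gamma> \<Longrightarrow> \<exists>i j. x = ij_root i j \<and> 1 \<le> i \<and> i \<le> j \<and> j \<le> n"
    and "\<And>i j a b. ij_root i j \<in> \<Gamma> \<Longrightarrow> ij_root a b \<in> \<Gamma> \<Longrightarrow> i < a \<longleftrightarrow> j < b"
  shows "\<Gamma> \<in> AN n"
  unfolding AN_def
proof safe
  fix x assume "x \<in> \<Gamma>"
  then show "x \<in> pos_roots n" using assms(1) unfolding pos_roots_def by blast
next
  fix x y assume xy: "x \<in> \<Gamma>" "y \<in> \<Gamma>" "x \<noteq> y" "root_le n x y"
  obtain i j where x: "x = ij_root i j" "1 \<le> i" "i \<le> j" "j \<le> n" using assms(1) xy by blast
  obtain a b where y: "y = ij_root a b" "1 \<le> a" "a \<le> b" "b \<le> n" using assms(1) xy by blast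
  have "a \<le> i" "j \<le> b" using xy(4) x y root_le_ij_root_iff by blast+
  moreover have "i < a \<longleftrightarrow> j < b" "a < i \<longleftrightarrow> b < j" using assms(2) xy x y by blast+
  ultimately show False using xy x y by force
qed

lemma i_entries_AN:
  "\<Gamma> \<in> AN n \<Longrightarrow> i_entries n \<Gamma> = {i. \<exists>j. ij_root i j \<in> \<Gamma>}"
  unfolding i_entries_def using AN_bounds by blast

lemma j_entries_AN:
  "\<Gamma> \<in> AN n \<Longrightarrow> j_entries n \<Gamma> = {j. \<exists>i. ij_root i j \<in> \<Gamma>}"
  unfolding j_entries_def using AN_bounds by blast

lemma in_upper_ideal_iff:
  assumes "\<Gamma> \<in> AN n" "1 \<le> a" "a \<le> b" "b \<le> n"
  shows "ij_root a b \<in> upper_ideal n \<Gamma> \<longleftrightarrow> (\<exists>i j. ij_root i j \<in> \<Gamma> \<and> a \<le> i \<and> j \<le> b)"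
proof
  assume "ij_root a b \<in> upper_ideal n \<Gamma>"
  then obtain \<gamma> where \<gamma>: "\<gamma> \<in> \<Gamma>" "root_le n \<gamma> (ij_root a b)" unfolding upper_ideal_def by blast
  moreover obtain i j where "\<gamma> = ij_root i j" using \<gamma>(1) by (rule AN_is_ij_root[OF assms(1)])
  ultimately have ij: "ij_root i j \<in> \<Gamma>" "root_le n (ij_root i j) (ij_root a b)" by simp_all
  then have "a \<le> i \<and> j \<le> b"
    by (simp only: root_le_ij_root_iff[OF AN_bounds[OF assms(1) ij(1)] assms(2-4)])
  with ij(1) show "\<exists>i j. ij_root i j \<in> \<Gamma> \<and> a \<le> i \<and> j \<le> b" by blast
next
  assume "\<exists>i j. ij_root i j \<in> \<Gamma> \<and> a \<le> i \<and> j \<le> b"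
  then obtain i j where ij: "ij_root i j \<in> \<Gamma>" "a \<le> i \<and> j \<le> b" by blast
  then have "root_le n (ij_root i j) (ij_root a b)"
    by (simp only: root_le_ij_root_iff[OF AN_bounds[OF assms(1) ij(1)] assms(2-4)])
  moreover have "ij_root a b \<in> pos_roots n" using assms(2-4) by (simp add: ij_root_in_pos_roots_iff)
  ultimately show "ij_root a b \<in> upper_ideal n \<Gamma>" using ij(1) unfolding upper_ideal_def by blast
qed

lemma in_lower_ideal_iff:
  assumes "\<Gamma> \<in> AN n" "1 \<le> a" "a \<le> b" "b \<le> n"
  shows "ij_root a b \<in> lower_ideal n \<Gamma> \<longleftrightarrow> (\<exists>i j. ij_root i j \<in> \<Gamma> \<and> i \<le> a \<and> b \<le> j)"
proof
  assume "ij_root a b \<in> lower_ideal n \<Gamma>"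
  then obtain \<gamma> where \<gamma>: "\<gamma> \<in> \<Gamma>" "root_le n (ij_root a b) \<gamma>" unfolding lower_ideal_def by blast
  moreover obtain i j where "\<gamma> = ij_root i j" using \<gamma>(1) by (rule AN_is_ij_root[OF assms(1)])
  ultimately have ij: "ij_root i j \<in> \<Gamma>" "root_le n (ij_root a b) (ij_root i j)" by simp_all
  then have "i \<le> a \<and> b \<le> j"
    by (simp only: root_le_ij_root_iff[OF assms(2-4) AN_bounds[OF assms(1) ij(1)]])
  with ij(1) show "\<exists>i j. ij_root i j \<in> \<Gamma> \<and> i \<le> a \<and> b \<le> j" by blast
next
  assume "\<exists>i j. ij_root i j \<in> \<Gamma> \<and> i \<le> a \<and> b \<le> j"
  then obtain i j where ij: "ij_root i j \<in> \<Gamma>" "i \<le> a \<and> b \<le> j" by blast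
  then have "root_le n (ij_root a b) (ij_root i j)"
    by (simp only: root_le_ij_root_iff[OF assms(2-4) AN_bounds[OF assms(1) ij(1)]])
  moreover have "ij_root a b \<in> pos_roots n" using assms(2-4) by (simp add: ij_root_in_pos_roots_iff)
  ultimately show "ij_root a b \<in> lower_ideal n \<Gamma>" using ij(1) unfolding lower_ideal_def by blast
qed

lemma upper_ideal_mono:
  assumes "ij_root a b \<in> upper_ideal n \<Gamma>" "1 \<le> p" "p \<le> a" "b \<le> q" "q \<le> n"
  shows "ij_root p q \<in> upper_ideal n \<Gamma>"
proof -
  obtain \<gamma> where \<gamma>: "\<gamma> \<in> \<Gamma>" "root_le n \<gamma> (ij_root a b)" and "ij_root a b \<in> pos_roots n"
    using assms(1) unfolding upper_ideal_def by blast
  then have ab: "1 \<le> a" "a \<le> b" "b \<le> n" unfolding ij_root_in_pos_roots_iff by blast+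
  have pq: "1 \<le> p" "p \<le> q" "q \<le> n" using ab assms by linarith+
  have "root_le n (ij_root a b) (ij_root p q)"
    using assms(3,4) by (simp only: root_le_ij_root_iff[OF ab pq])
  then have "root_le n \<gamma> (ij_root p q)" by (rule root_le_trans[OF \<gamma>(2)])
  with \<gamma>(1) pq show ?thesis unfolding upper_ideal_def by (auto simp: ij_root_in_pos_roots_iff)
qed

subsection \<open>The reverse operator on end points\<close>

lemma reverse_op_AN: "\<Gamma> \<in> AN n \<Longrightarrow> reverse_op n \<Gamma> \<in> AN n"
  using reverse_op_bij bij_betwE by blast

text \<open>Enlarging an interval never leaves the upper ideal, so maximality in the complement need
  only be tested on the two enlargements by one point. At the borders 1 and \<open>n\<close> such an
  enlargement does not exist.\<close>

lemma in_reverse_op_iff: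
  assumes \<Gamma>: "\<Gamma> \<in> AN n"
  shows "ij_root a b \<in> reverse_op n \<Gamma> \<longleftrightarrow>
    1 \<le> a \<and> a \<le> b \<and> b \<le> n \<and> ij_root a b \<notin> upper_ideal n \<Gamma> \<and>
    (a = 1 \<or> ij_root (a - 1) b \<in> upper_ideal n \<Gamma>) \<and>
    (b = n \<or> ij_root a (b + 1) \<in> upper_ideal n \<Gamma>)"
    (is "?L \<longleftrightarrow> ?R")
proof
  note R = reverse_op_AN[OF \<Gamma>]
  assume L: ?L
  have b: "1 \<le> a" "a \<le> b" "b \<le> n" using AN_bounds[OF R L] .
  have not: "ij_root a b \<notin> upper_ideal n \<Gamma>"
    using L unfolding reverse_op_def max_elems_def by blast
  have max: "p = a \<and> q = b"
    if "1 \<le> p" "p \<le> a" "b \<le> q" "q \<le> n" "ij_root p q \<notin> upper_ideal n \<Gamma>" for p q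
  proof -
    have "ij_root p q \<in> pos_roots n" using that b by (simp add: ij_root_in_pos_roots_iff)
    moreover have "root_le n (ij_root a b) (ij_root p q)"
      using that b by (simp add: root_le_ij_root_iff)
    ultimately have "ij_root p q = ij_root a b"
      using L that unfolding reverse_op_def max_elems_def by blast
    then show ?thesis using that b by (simp add: ij_root_inject)
  qed
  have "ij_root (a - 1) b \<in> upper_ideal n \<Gamma>" if "a \<noteq> 1"
    using max[of "a - 1" b] b that by force
  moreover have "ij_root a (b + 1) \<in> upper_ideal n \<Gamma>" if "b \<noteq> n"
    using max[of a "b + 1"] b that by force
  ultimately show ?R using b not by blast
next
  assume R: ?R
  then have "ij_root a b \<in> pos_roots n - upper_ideal n \<Gamma>"
    by (simp add: ij_root_in_pos_roots_iff)
  moreover have "y = ij_root a b"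
    if y: "y \<in> pos_roots n - upper_ideal n \<Gamma>" "root_le n (ij_root a b) y" for y
  proof -
    obtain p q where pq: "y = ij_root p q" "1 \<le> p" "p \<le> q" "q \<le> n"
      using y unfolding pos_roots_def by blast
    have "1 \<le> a" "a \<le> b" "b \<le> n" using R by blast+
    then have le: "p \<le> a" "b \<le> q" using y(2) pq(1) root_le_ij_root_iff[OF _ _ _ pq(2-)] by blast+
    have "p = a"
    proof (rule ccontr)
      assume "p \<noteq> a"
      with le pq have ne: "a \<noteq> 1" "p \<le> a - 1" by linarith+
      \<comment> \<open>The interval [p, q] contains [a - 1, b] and would therefore lie in the upper
        ideal too.\<close>
      with R have "ij_root (a - 1) b \<in> upper_ideal n \<Gamma>" by blast
      from upper_ideal_mono[OF this pq(2) ne(2) le(2) pq(4)] y pq show False by blast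
    qed
    moreover have "q = b"
    proof (rule ccontr)
      assume "q \<noteq> b"
      with le pq have ne: "b \<noteq> n" "b + 1 \<le> q" by linarith+
      with R have "ij_root a (b + 1) \<in> upper_ideal n \<Gamma>" by blast
      from upper_ideal_mono[OF this pq(2) le(1) ne(2) pq(4)] y pq show False by blast
    qed
    ultimately show ?thesis using pq by simp
  qed
  ultimately show ?L unfolding reverse_op_def max_elems_def by blast
qed

text \<open>Simple roots are the minimal positive roots: an interval inside [a, a] is [a, a]
  itself.\<close>

lemma simple_in_upper_ideal_iff:
  assumes "\<Gamma> \<in> AN n" "1 \<le> a" "a \<le> n"
  shows "ij_root a a \<in> upper_ideal n \<Gamma> \<longleftrightarrow> ij_root a a \<in> \<Gamma>"
  using in_upper_ideal_iff[of \<Gamma> n a a] AN_bounds(2)[OF assms(1)] assms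
  by (metis le_antisym le_refl le_trans)

lemma i_entries_reverse_op:
  assumes \<Gamma>: "\<Gamma> \<in> AN n"
  shows "i_entries n (reverse_op n \<Gamma>) =
    {a \<in> {1..n}. (a = 1 \<or> a - 1 \<in> i_entries n \<Gamma>) \<and> ij_root a a \<notin> \<Gamma>}" (is "?A = ?B")
proof (intro set_eqI iffI)
  fix a assume "a \<in> ?A"
  then obtain b where "ij_root a b \<in> reverse_op n \<Gamma>"
    using i_entries_AN[OF reverse_op_AN[OF \<Gamma>]] by blast
  then have b: "1 \<le> a" "a \<le> b" "b \<le> n" "ij_root a b \<notin> upper_ideal n \<Gamma>"
    "a = 1 \<or> ij_root (a - 1) b \<in> upper_ideal n \<Gamma>"
    using in_reverse_op_iff[OF \<Gamma>] by blast+
  note no = in_upper_ideal_iff[OF \<Gamma> b(1-3)] b(4)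
  have "ij_root a a \<notin> \<Gamma>" using no b(2) by blast
  moreover have "a - 1 \<in> i_entries n \<Gamma>" if "a \<noteq> 1"
  proof -
    have "1 \<le> a - 1" "a - 1 \<le> b" using that b by auto
    \<comment> \<open>This member of \<Gamma> lies in [a - 1, b] but not in [a, b], so it starts
      exactly at \<open>a - 1\<close>.\<close>
    then obtain i j where ij: "ij_root i j \<in> \<Gamma>" "a - 1 \<le> i" "j \<le> b"
      using in_upper_ideal_iff[OF \<Gamma>, of "a - 1" b] b that by auto
    with no have "\<not> a \<le> i" by blast
    with ij have "i = a - 1" by simp
    with ij show ?thesis using i_entries_AN[OF \<Gamma>] by blast
  qed
  ultimately show "a \<in> ?B" using b by auto
next
  fix a assume "a \<in> ?B"
  then have a: "1 \<le> a" "a \<le> n" "ij_root a a \<notin> \<Gamma>" "a = 1 \<or> a - 1 \<in> i_entries n \<Gamma>" by auto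
  let ?P = "\<lambda>b. a \<le> b \<and> b \<le> n \<and> ij_root a b \<notin> upper_ideal n \<Gamma>"
  have P: "?P a" using a simple_in_upper_ideal_iff[OF \<Gamma>] by simp
  \<comment> \<open>The interval [a, a] is extended to the right as far as it stays outside the
    upper ideal; only maximality to the left then remains to be checked.\<close>
  define b where "b = (GREATEST b. ?P b)"
  have b: "?P b" unfolding b_def by (rule GreatestI_nat[of ?P a n]) (use P in auto)
  have "\<not> ?P (b + 1)" using Greatest_le_nat[of ?P "b + 1" n] unfolding b_def by auto
  with b have b': "b = n \<or> ij_root a (b + 1) \<in> upper_ideal n \<Gamma>" by auto
  have "ij_root (a - 1) b \<in> upper_ideal n \<Gamma>" if ne: "a \<noteq> 1"
  proof -
    have a1: "1 \<le> a - 1" "a - 1 \<le> b" using a ne b by auto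
    obtain j where j: "ij_root (a - 1) j \<in> \<Gamma>" using a ne i_entries_AN[OF \<Gamma>] by blast
    have "j \<le> b"
    proof (rule ccontr)
      assume nb: "\<not> j \<le> b"
      then have "b + 1 \<le> n" using AN_bounds(3)[OF \<Gamma> j] by simp
      \<comment> \<open>If [a - 1, j] reached beyond \<open>b\<close>, it would properly contain the
        member of \<Gamma> found inside [a, b + 1].\<close>
      with b' b obtain p q where pq: "ij_root p q \<in> \<Gamma>" "a \<le> p" "q \<le> b + 1"
        using in_upper_ideal_iff[OF \<Gamma> a(1), of "b + 1"] by force
      then show False using AN_nested_eq[OF \<Gamma> pq(1) j] nb a by fastforce
    qed
    then show ?thesis using in_upper_ideal_iff[OF \<Gamma> a1] b j by blast
  qed
  then have "ij_root a b \<in> reverse_op n \<Gamma>"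
    using in_reverse_op_iff[OF \<Gamma>] a b b' by blast
  then show "a \<in> ?A" using i_entries_AN[OF reverse_op_AN[OF \<Gamma>]] by blast
qed

lemma j_entries_reverse_op:
  assumes \<Gamma>: "\<Gamma> \<in> AN n"
  shows "j_entries n (reverse_op n \<Gamma>) =
    {b \<in> {1..n}. (b = n \<or> b + 1 \<in> j_entries n \<Gamma>) \<and> ij_root b b \<notin> \<Gamma>}" (is "?A = ?B")
proof (intro set_eqI iffI)
  fix b assume "b \<in> ?A"
  then obtain a where "ij_root a b \<in> reverse_op n \<Gamma>"
    using j_entries_AN[OF reverse_op_AN[OF \<Gamma>]] by blast
  then have b: "1 \<le> a" "a \<le> b" "b \<le> n" "ij_root a b \<notin> upper_ideal n \<Gamma>"
    "b = n \<or> ij_root a (b + 1) \<in> upper_ideal n \<Gamma>"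
    using in_reverse_op_iff[OF \<Gamma>] by blast+
  note no = in_upper_ideal_iff[OF \<Gamma> b(1-3)] b(4)
  have "ij_root b b \<notin> \<Gamma>" using no b(2) by blast
  moreover have "b + 1 \<in> j_entries n \<Gamma>" if "b \<noteq> n"
  proof -
    have "a \<le> b + 1" "b + 1 \<le> n" using that b by auto
    then obtain i j where ij: "ij_root i j \<in> \<Gamma>" "a \<le> i" "j \<le> b + 1"
      using in_upper_ideal_iff[OF \<Gamma>, of a "b + 1"] b that by auto
    with no have "\<not> j \<le> b" by blast
    with ij have "j = b + 1" by simp
    with ij show ?thesis using j_entries_AN[OF \<Gamma>] by blast
  qed
  ultimately show "b \<in> ?B" using b by auto
next
  fix b assume "b \<in> ?B"
  then have b: "1 \<le> b" "b \<le> n" "ij_root b b \<notin> \<Gamma>" "b = n \<or> b + 1 \<in> j_entries n \<Gamma>" by auto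
  let ?P = "\<lambda>a. 1 \<le> a \<and> a \<le> b \<and> ij_root a b \<notin> upper_ideal n \<Gamma>"
  have P: "?P b" using b simple_in_upper_ideal_iff[OF \<Gamma>] by simp
  \<comment> \<open>Mirror image of the greedy extension: [b, b] is extended to the left.\<close>
  define a where "a = (LEAST a. ?P a)"
  have a: "?P a" unfolding a_def by (rule LeastI[of ?P, OF P])
  \<comment> \<open>For \<open>a = 1\<close> the predicate fails only through its bound
    \<open>1 \<le> a\<close>, since \<open>a - 1\<close> is 0; this yields the alternative
    \<open>a = 1\<close> below.\<close>
  have "\<not> ?P (a - 1)"
    using not_less_Least[of "a - 1" ?P] a unfolding a_def[symmetric] by auto
  with a have a': "a = 1 \<or> ij_root (a - 1) b \<in> upper_ideal n \<Gamma>" by auto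
  have "ij_root a (b + 1) \<in> upper_ideal n \<Gamma>" if ne: "b \<noteq> n"
  proof -
    have b1: "1 \<le> a" "a \<le> b + 1" "b + 1 \<le> n" using a ne b by auto
    obtain i where i: "ij_root i (b + 1) \<in> \<Gamma>" using b ne j_entries_AN[OF \<Gamma>] by blast
    have "a \<le> i"
    proof (rule ccontr)
      assume na: "\<not> a \<le> i"
      then have le: "1 \<le> a - 1" "a - 1 \<le> b" using AN_bounds(1)[OF \<Gamma> i] conjunct1[OF conjunct2[OF a]]
        by linarith+
      with a' have "ij_root (a - 1) b \<in> upper_ideal n \<Gamma>" by auto
      then obtain p q where pq: "ij_root p q \<in> \<Gamma>" "a - 1 \<le> p" "q \<le> b"
        unfolding in_upper_ideal_iff[OF \<Gamma> le b(2)] by blast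
      then show False using AN_nested_eq[OF \<Gamma> pq(1) i] na by fastforce
    qed
    then show ?thesis using in_upper_ideal_iff[OF \<Gamma> b1] i by blast
  qed
  then have "ij_root a b \<in> reverse_op n \<Gamma>"
    using in_reverse_op_iff[OF \<Gamma>] a b a' by blast
  then show "b \<in> ?A" using j_entries_AN[OF reverse_op_AN[OF \<Gamma>]] by blast
qed

subsection \<open>Duality\<close>

text \<open>For a member of \<open>A\<close> this is its position counted from 0. It is also
  evaluated at non-members, to compare a set with its complement.\<close>

definition rank :: "nat set \<Rightarrow> nat \<Rightarrow> nat" where
  "rank A x = card {y \<in> A. y < x}"

lemma rank_less:
  assumes "finite A" "x \<in> A" "x < y"
  shows "rank A x < rank A y"
  unfolding rank_def using assms by (intro psubset_card_mono) auto

lemma rank_inject: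
  assumes "finite A" "x \<in> A" "y \<in> A" "rank A x = rank A y"
  shows "x = y"
  using rank_less[OF assms(1,2), of y] rank_less[OF assms(1,3), of x] assms(4)
  by (cases x y rule: linorder_cases) auto

lemma rank_less_iff:
  assumes "finite A" "x \<in> A" "y \<in> A"
  shows "rank A x < rank A y \<longleftrightarrow> x < y"
  using rank_less[OF assms(1,2), of y] rank_less[OF assms(1,3), of x]
  by (cases x y rule: linorder_cases) auto

lemma rank_nth:
  assumes "finite A" "k < card A"
  shows "rank A (sorted_list_of_set A ! k) = k"
proof -
  let ?l = "sorted_list_of_set A"
  have less: "?l ! i < ?l ! k \<longleftrightarrow> i < k" if "i < card A" for i
  proof -
    have "sorted_wrt (<) ?l" by simp
    then show ?thesis
      using that assms(2) sorted_wrt_nth_less[of "(<)" ?l i k] sorted_wrt_nth_less[of "(<)" ?l k i]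
      by (cases i k rule: linorder_cases) auto
  qed
  have "A = set ?l" using assms(1) by simp
  also have "\<dots> = (!) ?l ` {..<card A}" by (auto simp: in_set_conv_nth image_iff)
  finally have "{y \<in> A. y < ?l ! k} = {y \<in> (!) ?l ` {..<card A}. y < ?l ! k}" by simp
  also have "\<dots> = (!) ?l ` {..<k}"
    using assms(2) by (auto simp: less)
  finally have "rank A (?l ! k) = card ((!) ?l ` {..<k})" unfolding rank_def by simp
  also have "\<dots> = k"
    using assms(2) by (subst card_image) (auto intro!: inj_on_nth)
  finally show ?thesis .
qed

text \<open>Zipping pairs entries at equal positions, and position is rank by
  \<open>rank_nth\<close>. This replaces the lists in the definition of the dual by a
  relation.\<close>

lemma zip_sorted_list_of_set:
  assumes "finite A" "finite B" "card A = card B"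
  shows "set (zip (sorted_list_of_set A) (sorted_list_of_set B)) =
    {(x, y). x \<in> A \<and> y \<in> B \<and> rank A x = rank B y}"
proof (intro set_eqI iffI)
  fix p assume "p \<in> set (zip (sorted_list_of_set A) (sorted_list_of_set B))"
  then obtain k where "k < card A"
    "p = (sorted_list_of_set A ! k, sorted_list_of_set B ! k)"
    using assms by (auto simp: in_set_zip prod_eq_iff)
  then show "p \<in> {(x, y). x \<in> A \<and> y \<in> B \<and> rank A x = rank B y}"
    using assms rank_nth[of A k] rank_nth[of B k]
      nth_mem[of k "sorted_list_of_set A"] nth_mem[of k "sorted_list_of_set B"] by simp
next
  fix p assume "p \<in> {(x, y). x \<in> A \<and> y \<in> B \<and> rank A x = rank B y}"
  then obtain x y where p: "p = (x, y)" "x \<in> A" "y \<in> B" "rank A x = rank B y" by blast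
  obtain k where k: "k < card A" "x = sorted_list_of_set A ! k"
    using p(2) assms(1) by (metis in_set_conv_nth set_sorted_list_of_set length_sorted_list_of_set)
  have "sorted_list_of_set B ! k = y"
    using rank_inject[of B "sorted_list_of_set B ! k" y] rank_nth[of A k] rank_nth[of B k]
      nth_mem[of k "sorted_list_of_set B"] p k assms by simp
  then show "p \<in> set (zip (sorted_list_of_set A) (sorted_list_of_set B))"
    using p k assms by (auto simp: in_set_zip intro!: exI[of _ k])
qed

section \<open>Counting the end points of an antichain\<close>

lemma finite_entries: "finite (i_entries n \<Gamma>)" "finite (j_entries n \<Gamma>)"
  by (rule finite_subset[of _ "{1..n}"]; auto simp: i_entries_def j_entries_def)+

text \<open>Each member of an antichain is determined by either of its ends, so both projections are
  injective. Counts of left and of right ends thereby become counts of sets of intervals, which can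
  be compared.\<close>

lemma AN_entries_card:
  assumes \<Gamma>: "\<Gamma> \<in> AN n"
  shows "card {i \<in> i_entries n \<Gamma>. P i} = card {(i, j). ij_root i j \<in> \<Gamma> \<and> P i}"
    and "card {j \<in> j_entries n \<Gamma>. P j} = card {(i, j). ij_root i j \<in> \<Gamma> \<and> P j}"
proof -
  have inj: "inj_on fst {(i, j). ij_root i j \<in> \<Gamma> \<and> P i}" "inj_on snd {(i, j). ij_root i j \<in> \<Gamma> \<and> P j}"
    using AN_less_iff[OF \<Gamma>] by (auto simp: inj_on_def) (metis linorder_neq_iff)+
  have img: "{i \<in> i_entries n \<Gamma>. P i} = fst ` {(i, j). ij_root i j \<in> \<Gamma> \<and> P i}"
    "{j \<in> j_entries n \<Gamma>. P j} = snd ` {(i, j). ij_root i j \<in> \<Gamma> \<and> P j}"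
    by (auto simp: i_entries_AN[OF \<Gamma>] j_entries_AN[OF \<Gamma>] image_iff)
  show "card {i \<in> i_entries n \<Gamma>. P i} = card {(i, j). ij_root i j \<in> \<Gamma> \<and> P i}"
    and "card {j \<in> j_entries n \<Gamma>. P j} = card {(i, j). ij_root i j \<in> \<Gamma> \<and> P j}"
    unfolding img by (rule card_image[OF inj(1)], rule card_image[OF inj(2)])
qed

lemma finite_AN_pairs:
  assumes "\<Gamma> \<in> AN n" shows "finite {(i, j). ij_root i j \<in> \<Gamma> \<and> P i j}"
  by (rule finite_subset[of _ "{1..n} \<times> {1..n}"]) (use AN_bounds[OF assms] in fastforce)+

text \<open>By \<open>AN_less_iff\<close>, the members starting before \<open>i\<close> are exactly
  those ending before \<open>j\<close>.\<close>

lemma AN_rank_eq: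
  assumes \<Gamma>: "\<Gamma> \<in> AN n" and ij: "ij_root i j \<in> \<Gamma>"
  shows "rank (i_entries n \<Gamma>) i = rank (j_entries n \<Gamma>) j"
proof -
  have "{(a, b). ij_root a b \<in> \<Gamma> \<and> a < i} = {(a, b). ij_root a b \<in> \<Gamma> \<and> b < j}"
    using AN_less_iff[OF \<Gamma> _ ij] by blast
  then show ?thesis unfolding rank_def AN_entries_card[OF \<Gamma>] by simp
qed

text \<open>The right end belonging to a left end \<open>i\<close> is recovered as the element of
  \<open>j_entries\<close> having the rank of \<open>i\<close>.\<close>

lemma AN_subset_of_entries_eq:
  assumes "\<Gamma> \<in> AN n" "\<Delta> \<in> AN n"
    and "i_entries n \<Gamma> = i_entries n \<Delta>" "j_entries n \<Gamma> = j_entries n \<Delta>"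
  shows "\<Gamma> \<subseteq> \<Delta>"
proof
  fix x assume x: "x \<in> \<Gamma>"
  then obtain i j where ij: "x = ij_root i j" by (rule AN_is_ij_root[OF assms(1)])
  with x have *: "i \<in> i_entries n \<Gamma>" "j \<in> j_entries n \<Gamma>"
    by (auto simp: i_entries_AN[OF assms(1)] j_entries_AN[OF assms(1)])
  then obtain b where b: "ij_root i b \<in> \<Delta>" using assms(3) i_entries_AN[OF assms(2)] by blast
  then have "b \<in> j_entries n \<Gamma>" using assms(4) j_entries_AN[OF assms(2)] by blast
  moreover have "rank (j_entries n \<Gamma>) b = rank (j_entries n \<Gamma>) j"
    using AN_rank_eq[OF assms(2) b] AN_rank_eq[OF assms(1), of i j] x ij assms(3,4) by simp
  ultimately have "b = j" using rank_inject[OF finite_entries(2)] * by blast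
  then show "x \<in> \<Delta>" using b ij by simp
qed

lemma AN_eqI_entries:
  assumes "\<Gamma> \<in> AN n" "\<Delta> \<in> AN n"
    and "i_entries n \<Gamma> = i_entries n \<Delta>" "j_entries n \<Gamma> = j_entries n \<Delta>"
  shows "\<Gamma> = \<Delta>"
  using AN_subset_of_entries_eq[of \<Gamma> n \<Delta>] AN_subset_of_entries_eq[of \<Delta> n \<Gamma>] assms by auto

lemma rank_entries_le:
  assumes "\<Gamma> \<in> AN n"
  shows "rank (j_entries n \<Gamma>) x \<le> rank (i_entries n \<Gamma>) x"
  unfolding rank_def AN_entries_card[OF assms] using AN_bounds(2)[OF assms]
  by (intro card_mono finite_AN_pairs[OF assms]) force

text \<open>The members ending before \<open>x\<close> are among those starting before
  \<open>x\<close>, so equal counts mean equal finite sets: no member starts before \<open>x\<close>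
  and ends at \<open>x\<close> or later.\<close>

lemma rank_entries_eq_iff:
  assumes "\<Gamma> \<in> AN n"
  shows "rank (j_entries n \<Gamma>) x = rank (i_entries n \<Gamma>) x \<longleftrightarrow>
    (\<forall>i j. ij_root i j \<in> \<Gamma> \<longrightarrow> i < x \<longrightarrow> j < x)"
proof -
  let ?J = "{(i, j). ij_root i j \<in> \<Gamma> \<and> j < x}" and ?I = "{(i, j). ij_root i j \<in> \<Gamma> \<and> i < x}"
  have "?J \<subseteq> ?I" using AN_bounds(2)[OF assms] by force
  note card_subset_eq[OF finite_AN_pairs[OF assms] this]
  then have "card ?J = card ?I \<longleftrightarrow> ?J = ?I" by (intro iffI) (assumption | simp only:)+
  then show ?thesis
    unfolding rank_def AN_entries_card[OF assms] using \<open>?J \<subseteq> ?I\<close> by blast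
qed

text \<open>The set and its complement share the \<open>x - 1\<close> numbers below
  \<open>x\<close>. The form with \<open>+ 1\<close> avoids truncated subtraction.\<close>

lemma rank_compl:
  assumes "A \<subseteq> {1..n}" "1 \<le> x" "x \<le> n + 1"
  shows "rank ({1..n} - A) x + rank A x + 1 = x"
proof -
  have "rank ({1..n} - A) x + rank A x
      = card ({y \<in> {1..n} - A. y < x} \<union> {y \<in> A. y < x})"
    unfolding rank_def by (rule card_Un_disjoint[symmetric]) (auto simp: finite_subset[OF assms(1)])
  also have "{y \<in> {1..n} - A. y < x} \<union> {y \<in> A. y < x} = {1..<x}" using assms by auto
  finally show ?thesis using assms(2) by simp
qed

text \<open>As \<open>y\<close> is missing from \<open>A\<close>, at most \<open>x - y - 1\<close>
  elements of \<open>A\<close> lie between \<open>y\<close> and \<open>x\<close>.\<close>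

lemma rank_le_rank_add:
  assumes "finite A" "y \<notin> A" "y < x"
  shows "rank A x + y + 1 \<le> rank A y + x"
proof -
  have "{z \<in> A. z < x} \<subseteq> {z \<in> A. z < y} \<union> {y<..<x}"
    using assms(2) by (auto simp: not_less) (metis le_neq_implies_less)
  then have "rank A x \<le> card ({z \<in> A. z < y} \<union> {y<..<x})"
    unfolding rank_def using assms(1) by (intro card_mono) auto
  also have "\<dots> \<le> rank A y + card {y<..<x}" unfolding rank_def by (rule card_Un_le)
  finally show ?thesis using assms(3) by simp
qed

lemma entries_subset: "i_entries n \<Gamma> \<subseteq> {1..n}" "j_entries n \<Gamma> \<subseteq> {1..n}"
  by (auto simp: i_entries_def j_entries_def)

lemma card_compl_entries:
  assumes "\<Gamma> \<in> AN n"
  shows "card ({1..n} - j_entries n \<Gamma>) = card ({1..n} - i_entries n \<Gamma>)"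
  using AN_entries_card[OF assms, of "\<lambda>_. True"] entries_subset[of n \<Gamma>]
  by (simp add: card_Diff_subset finite_entries)

section \<open>The dual as a relation between the two complements\<close>

text \<open>Stated on indices because \<open>ij_root x y\<close> need not determine \<open>x\<close>
  and \<open>y\<close> before \<open>x \<le> y\<close> is known; for instance,
  \<open>ij_root (y + 1) y\<close> is 0 for every \<open>y\<close>.\<close>

definition dual_pair :: "nat \<Rightarrow> (nat \<Rightarrow> int) set \<Rightarrow> nat \<Rightarrow> nat \<Rightarrow> bool" where
  "dual_pair n \<Gamma> x y \<longleftrightarrow> x \<in> {1..n} - j_entries n \<Gamma> \<and> y \<in> {1..n} - i_entries n \<Gamma> \<and>
    rank ({1..n} - j_entries n \<Gamma>) x = rank ({1..n} - i_entries n \<Gamma>) y"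

lemma zip_compl_entries:
  assumes "\<Gamma> \<in> AN n"
  shows "set (zip (sorted_list_of_set ({1..n} - j_entries n \<Gamma>))
    (sorted_list_of_set ({1..n} - i_entries n \<Gamma>))) = {(x, y). dual_pair n \<Gamma> x y}"
  unfolding dual_pair_def
  by (rule zip_sorted_list_of_set[OF _ _ card_compl_entries[OF assms]]) simp_all

lemma in_dual_AN_iff_dual_pair:
  assumes "\<Gamma> \<in> AN n"
  shows "z \<in> dual_AN n \<Gamma> \<longleftrightarrow> (\<exists>x y. z = ij_root x y \<and> dual_pair n \<Gamma> x y)"
  unfolding dual_AN_def set_map zip_compl_entries[OF assms] by auto

text \<open>Below \<open>x\<close> there are at least as many left ends as right ends, so
  \<open>x\<close> ranks at least as high among the non-right-ends as among the non-left-ends. If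
  \<open>y < x\<close>, then \<open>y\<close> itself counts among the non-left-ends below
  \<open>x\<close>, and the ranks of \<open>x\<close> and \<open>y\<close> could not agree.\<close>

lemma dual_pair_le:
  assumes \<Gamma>: "\<Gamma> \<in> AN n" and xy: "dual_pair n \<Gamma> x y"
  shows "x \<le> y"
proof (rule ccontr)
  assume "\<not> x \<le> y"
  then have "y < x" by simp
  have x: "1 \<le> x" "x \<le> n" and y: "1 \<le> y" "y \<le> n" "y \<notin> i_entries n \<Gamma>"
    and eq: "rank ({1..n} - j_entries n \<Gamma>) x = rank ({1..n} - i_entries n \<Gamma>) y"
    using xy unfolding dual_pair_def by simp_all
  have "rank (j_entries n \<Gamma>) x \<le> rank (i_entries n \<Gamma>) x" by (rule rank_entries_le[OF \<Gamma>])
  moreover have "rank (i_entries n \<Gamma>) x + y + 1 \<le> rank (i_entries n \<Gamma>) y + x"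
    using y(3) \<open>y < x\<close> by (intro rank_le_rank_add finite_entries)
  moreover have "rank ({1..n} - j_entries n \<Gamma>) x + rank (j_entries n \<Gamma>) x + 1 = x"
    using x by (intro rank_compl entries_subset) simp_all
  moreover have "rank ({1..n} - i_entries n \<Gamma>) y + rank (i_entries n \<Gamma>) y + 1 = y"
    using y by (intro rank_compl entries_subset) simp_all
  ultimately show False using eq by linarith
qed

lemma ij_root_in_dual_AN_iff:
  assumes "\<Gamma> \<in> AN n" "x \<le> y"
  shows "ij_root x y \<in> dual_AN n \<Gamma> \<longleftrightarrow> dual_pair n \<Gamma> x y"
proof
  assume "ij_root x y \<in> dual_AN n \<Gamma>"
  then obtain a b where eq: "ij_root x y = ij_root a b" and ab: "dual_pair n \<Gamma> a b"
    unfolding in_dual_AN_iff_dual_pair[OF assms(1)] by blast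
  then show "dual_pair n \<Gamma> x y"
    using ij_root_inject[OF assms(2) dual_pair_le[OF assms(1) ab]] by simp
qed (auto simp: in_dual_AN_iff_dual_pair[OF assms(1)])

lemma dual_AN_pos_roots:
  assumes "\<Gamma> \<in> AN n" "x \<in> dual_AN n \<Gamma>"
  shows "\<exists>i j. x = ij_root i j \<and> 1 \<le> i \<and> i \<le> j \<and> j \<le> n"
proof -
  obtain a b where ab: "x = ij_root a b" "dual_pair n \<Gamma> a b"
    using assms(2) unfolding in_dual_AN_iff_dual_pair[OF assms(1)] by blast
  moreover have "1 \<le> a" "b \<le> n" using ab(2) unfolding dual_pair_def by simp_all
  moreover have "a \<le> b" using assms(1) ab(2) by (rule dual_pair_le)
  ultimately show ?thesis by blast
qed

lemma dual_pair_less_iff: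
  assumes "dual_pair n \<Gamma> i j" "dual_pair n \<Gamma> a b"
  shows "i < a \<longleftrightarrow> j < b"
proof -
  let ?A = "{1..n} - j_entries n \<Gamma>" and ?B = "{1..n} - i_entries n \<Gamma>"
  have "rank ?A i < rank ?A a \<longleftrightarrow> i < a" "rank ?B j < rank ?B b \<longleftrightarrow> j < b"
    by (rule rank_less_iff; use assms in \<open>simp add: dual_pair_def\<close>)+
  moreover have "rank ?A i = rank ?B j" "rank ?A a = rank ?B b"
    using assms unfolding dual_pair_def by blast+
  ultimately show ?thesis by simp
qed

lemma dual_AN_AN:
  assumes \<Gamma>: "\<Gamma> \<in> AN n"
  shows "dual_AN n \<Gamma> \<in> AN n"
proof (rule AN_I)
  fix i j a b assume *: "ij_root i j \<in> dual_AN n \<Gamma>" "ij_root a b \<in> dual_AN n \<Gamma>"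
  then have "ij_root i j \<in> pos_roots n" "ij_root a b \<in> pos_roots n"
    using dual_AN_pos_roots[OF \<Gamma>] unfolding pos_roots_def by blast+
  then have "i \<le> j" "a \<le> b" by (auto simp: ij_root_in_pos_roots_iff)
  with * have "dual_pair n \<Gamma> i j" "dual_pair n \<Gamma> a b"
    by (simp_all only: ij_root_in_dual_AN_iff[OF \<Gamma>])
  then show "i < a \<longleftrightarrow> j < b" by (rule dual_pair_less_iff)
qed (rule dual_AN_pos_roots[OF \<Gamma>])

lemma entries_dual_AN:
  assumes \<Gamma>: "\<Gamma> \<in> AN n"
  shows "i_entries n (dual_AN n \<Gamma>) = {1..n} - j_entries n \<Gamma>"
    and "j_entries n (dual_AN n \<Gamma>) = {1..n} - i_entries n \<Gamma>"
proof -
  let ?A = "{1..n} - j_entries n \<Gamma>" and ?B = "{1..n} - i_entries n \<Gamma>"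
  let ?z = "zip (sorted_list_of_set ?A) (sorted_list_of_set ?B)"
  have len: "length (sorted_list_of_set ?A) = length (sorted_list_of_set ?B)"
    using card_compl_entries[OF \<Gamma>] by simp
  \<comment> \<open>Each side forces \<open>x \<le> y\<close>, so the equivalence holds for all
    indices.\<close>
  have z: "ij_root x y \<in> dual_AN n \<Gamma> \<longleftrightarrow> (x, y) \<in> set ?z" for x y
    unfolding zip_compl_entries[OF \<Gamma>] mem_Collect_eq prod.case
    using dual_pair_le[OF \<Gamma>] ij_root_in_dual_AN_iff[OF \<Gamma>] AN_bounds(2)[OF dual_AN_AN[OF \<Gamma>]]
    by blast
  have proj: "{x. \<exists>y. (x, y) \<in> S} = fst ` S" "{y. \<exists>x. (x, y) \<in> S} = snd ` S" for S :: "(nat \<times> nat) set"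
    by force+
  have "i_entries n (dual_AN n \<Gamma>) = set (map fst ?z)" "j_entries n (dual_AN n \<Gamma>) = set (map snd ?z)"
    unfolding i_entries_AN[OF dual_AN_AN[OF \<Gamma>]] j_entries_AN[OF dual_AN_AN[OF \<Gamma>]] z set_map proj
    by (rule refl)+
  then show "i_entries n (dual_AN n \<Gamma>) = ?A" "j_entries n (dual_AN n \<Gamma>) = ?B"
    \<comment> \<open>Equal lengths ensure that zipping drops no element of either
      complement.\<close>
    unfolding map_fst_zip[OF len] map_snd_zip[OF len] by simp_all
qed

section \<open>Simple roots in the dual\<close>

text \<open>The point \<open>b\<close> is paired with itself iff no member starts at
  \<open>b\<close>, none ends at \<open>b\<close>, and none starts before \<open>b\<close> and ends
  at \<open>b\<close> or later. Together these say that no member contains \<open>b\<close>.\<close>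

lemma simple_in_dual_AN_iff:
  assumes \<Gamma>: "\<Gamma> \<in> AN n" and b: "1 \<le> b" "b \<le> n"
  shows "ij_root b b \<in> dual_AN n \<Gamma> \<longleftrightarrow> ij_root b b \<notin> lower_ideal n \<Gamma>"
proof -
  have "ij_root b b \<in> dual_AN n \<Gamma> \<longleftrightarrow> b \<notin> i_entries n \<Gamma> \<and> b \<notin> j_entries n \<Gamma> \<and>
      rank (j_entries n \<Gamma>) b = rank (i_entries n \<Gamma>) b"
  proof -
    have "rank ({1..n} - j_entries n \<Gamma>) b + rank (j_entries n \<Gamma>) b + 1 = b"
      "rank ({1..n} - i_entries n \<Gamma>) b + rank (i_entries n \<Gamma>) b + 1 = b"
      using b by (intro rank_compl entries_subset; simp)+
    then have "rank ({1..n} - j_entries n \<Gamma>) b = rank ({1..n} - i_entries n \<Gamma>) b \<longleftrightarrow>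
        rank (j_entries n \<Gamma>) b = rank (i_entries n \<Gamma>) b" by linarith
    moreover have "b \<in> {1..n}" using b by simp
    ultimately show ?thesis
      unfolding ij_root_in_dual_AN_iff[OF \<Gamma> order_refl] dual_pair_def by blast
  qed
  also have "\<dots> \<longleftrightarrow> \<not> (\<exists>i j. ij_root i j \<in> \<Gamma> \<and> i \<le> b \<and> b \<le> j)"
    unfolding rank_entries_eq_iff[OF \<Gamma>] unfolding i_entries_AN[OF \<Gamma>] j_entries_AN[OF \<Gamma>] mem_Collect_eq
  proof (intro iffI notI conjI allI impI)
    assume "(\<nexists>j. ij_root b j \<in> \<Gamma>) \<and> (\<nexists>i. ij_root i b \<in> \<Gamma>) \<and>
      (\<forall>i j. ij_root i j \<in> \<Gamma> \<longrightarrow> i < b \<longrightarrow> j < b)"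
    moreover assume "\<exists>i j. ij_root i j \<in> \<Gamma> \<and> i \<le> b \<and> b \<le> j"
    then obtain i j where "ij_root i j \<in> \<Gamma>" "i \<le> b" "b \<le> j" by blast
    \<comment> \<open>A member containing \<open>b\<close> either starts at \<open>b\<close> or, by
      the rank condition, ends before \<open>b\<close>; both are excluded.\<close>
    ultimately show False by (cases "i = b") fastforce+
  next
    assume no: "\<nexists>i j. ij_root i j \<in> \<Gamma> \<and> i \<le> b \<and> b \<le> j"
    show False if "\<exists>j. ij_root b j \<in> \<Gamma>"
      using that no AN_bounds(2)[OF \<Gamma>] by blast
    show False if "\<exists>i. ij_root i b \<in> \<Gamma>"
      using that no AN_bounds(2)[OF \<Gamma>] by blast
    show "j < b" if "ij_root i j \<in> \<Gamma>" "i < b" for i j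
      using that no by (meson less_imp_le not_less)
  qed
  also have "\<dots> \<longleftrightarrow> ij_root b b \<notin> lower_ideal n \<Gamma>"
    using in_lower_ideal_iff[OF \<Gamma>] b by simp
  finally show ?thesis .
qed

lemma simple_in_dual_reverse_iff:
  assumes \<Gamma>: "\<Gamma> \<in> AN n" and b: "1 \<le> b" "b \<le> n"
  shows "ij_root b b \<in> dual_AN n (reverse_op n \<Gamma>) \<longleftrightarrow> ij_root b b \<in> \<Gamma>"
  using simple_in_dual_AN_iff[OF reverse_op_AN[OF \<Gamma>] b] simple_in_upper_ideal_iff[OF \<Gamma> b] b
  by (simp add: lower_ideal_reverse_op ij_root_in_pos_roots_iff)

text \<open>A member [i, a] with \<open>i < a\<close> would need \<open>a \<noteq> 1\<close> and
  would contain [a - 1, a - 1].\<close>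

lemma simple_in_AN_left:
  assumes \<Gamma>: "\<Gamma> \<in> AN n" and "a \<in> j_entries n \<Gamma>" and "a = 1 \<or> ij_root (a - 1) (a - 1) \<in> \<Gamma>"
  shows "ij_root a a \<in> \<Gamma>"
proof -
  obtain i where i: "ij_root i a \<in> \<Gamma>" using assms j_entries_AN by blast
  have "i = a"
    using assms(3) AN_nested_eq[OF \<Gamma> _ i, of "a - 1" "a - 1"] AN_bounds[OF \<Gamma> i] by fastforce
  with i show ?thesis by simp
qed

lemma simple_in_AN_right:
  assumes \<Gamma>: "\<Gamma> \<in> AN n" and "b \<in> i_entries n \<Gamma>" and "b = n \<or> ij_root (b + 1) (b + 1) \<in> \<Gamma>"
  shows "ij_root b b \<in> \<Gamma>"
proof -
  obtain j where j: "ij_root b j \<in> \<Gamma>" using assms i_entries_AN by blast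
  have "j = b"
    using assms(3) AN_nested_eq[OF \<Gamma> _ j, of "b + 1" "b + 1"] AN_bounds[OF \<Gamma> j] by fastforce
  with j show ?thesis by simp
qed

section \<open>Comparison of end points\<close>

text \<open>This is the duality identity with the inverse cleared by applying the reverse operator
  to both sides.\<close>

lemma reverse_dual_reverse:
  assumes \<Gamma>: "\<Gamma> \<in> AN n"
  shows "reverse_op n (dual_AN n (reverse_op n \<Gamma>)) = dual_AN n \<Gamma>"
proof -
  let ?\<Delta> = "dual_AN n (reverse_op n \<Gamma>)"
  have \<Delta>: "?\<Delta> \<in> AN n" using \<Gamma> reverse_op_AN dual_AN_AN by blast
  note ent = entries_dual_AN[OF reverse_op_AN[OF \<Gamma>]]
  have J: "a \<in> j_entries n \<Gamma>" and I: "a \<in> i_entries n \<Gamma>" if "ij_root a a \<in> \<Gamma>" for a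
    using that i_entries_AN[OF \<Gamma>] j_entries_AN[OF \<Gamma>] by blast+
  have "i_entries n (reverse_op n ?\<Delta>) = {1..n} - j_entries n \<Gamma>"
  proof -
    \<comment> \<open>For \<open>a \<noteq> 1\<close>, the first condition says that
      \<open>a\<close> is no right end of \<Gamma> or that \<alpha>_(a-1) is in \<Gamma>. A right
      end \<open>a\<close> with \<open>a = 1\<close> or \<alpha>_(a-1) in \<Gamma> has \<alpha>_a in
      \<Gamma> by \<open>simple_in_AN_left\<close>, so the second condition rules it out.\<close>
    have key: "(a = 1 \<or> a - 1 \<in> {1..n} - j_entries n (reverse_op n \<Gamma>)) \<and> ij_root a a \<notin> \<Gamma>
        \<longleftrightarrow> a \<notin> j_entries n \<Gamma>" if "1 \<le> a" "a \<le> n" for a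
    proof (cases "a = 1")
      case True
      then show ?thesis using J[of a] simple_in_AN_left[OF \<Gamma>, of a] by blast
    next
      case False
      then have "a - 1 \<in> {1..n}" "a - 1 \<noteq> n" "a - 1 + 1 = a" using that by auto
      then have "a - 1 \<in> {1..n} - j_entries n (reverse_op n \<Gamma>) \<longleftrightarrow>
          \<not> (a \<in> j_entries n \<Gamma> \<and> ij_root (a - 1) (a - 1) \<notin> \<Gamma>)"
        unfolding j_entries_reverse_op[OF \<Gamma>] by simp
      then show ?thesis using J[of a] simple_in_AN_left[OF \<Gamma>, of a] False by blast
    qed
    show ?thesis
      unfolding i_entries_reverse_op[OF \<Delta>] ent
    proof (intro set_eqI)
      fix a
      show "a \<in> {a \<in> {1..n}. (a = 1 \<or> a - 1 \<in> {1..n} - j_entries n (reverse_op n \<Gamma>)) \<and>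
          ij_root a a \<notin> ?\<Delta>} \<longleftrightarrow> a \<in> {1..n} - j_entries n \<Gamma>"
        using key[of a] simple_in_dual_reverse_iff[OF \<Gamma>, of a]
        by (cases "a \<in> {1..n}") auto
    qed
  qed
  moreover have "j_entries n (reverse_op n ?\<Delta>) = {1..n} - i_entries n \<Gamma>"
  proof -
    \<comment> \<open>The mirror argument, with \<open>b = n\<close> as border case and
      \<open>simple_in_AN_right\<close> in place of the left version.\<close>
    have key: "(b = n \<or> b + 1 \<in> {1..n} - i_entries n (reverse_op n \<Gamma>)) \<and> ij_root b b \<notin> \<Gamma>
        \<longleftrightarrow> b \<notin> i_entries n \<Gamma>" if "1 \<le> b" "b \<le> n" for b
    proof (cases "b = n")
      case True
      then show ?thesis using I[of b] simple_in_AN_right[OF \<Gamma>, of b] by blast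
    next
      case False
      then have "b + 1 \<in> {1..n}" "b + 1 \<noteq> 1" "b + 1 - 1 = b" using that by auto
      then have "b + 1 \<in> {1..n} - i_entries n (reverse_op n \<Gamma>) \<longleftrightarrow>
          \<not> (b \<in> i_entries n \<Gamma> \<and> ij_root (b + 1) (b + 1) \<notin> \<Gamma>)"
        unfolding i_entries_reverse_op[OF \<Gamma>] by simp
      then show ?thesis using I[of b] simple_in_AN_right[OF \<Gamma>, of b] False by blast
    qed
    show ?thesis
      unfolding j_entries_reverse_op[OF \<Delta>] ent
    proof (intro set_eqI)
      fix b
      show "b \<in> {b \<in> {1..n}. (b = n \<or> b + 1 \<in> {1..n} - i_entries n (reverse_op n \<Gamma>)) \<and>
          ij_root b b \<notin> ?\<Delta>} \<longleftrightarrow> b \<in> {1..n} - i_entries n \<Gamma>"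
        using key[of b] simple_in_dual_reverse_iff[OF \<Gamma>, of b]
        by (cases "b \<in> {1..n}") auto
    qed
  qed
  ultimately show ?thesis
    using AN_eqI_entries[OF reverse_op_AN[OF \<Delta>] dual_AN_AN[OF \<Gamma>]] entries_dual_AN[OF \<Gamma>] by simp
qed

theorem mainTheorem3:
  fixes n :: nat and \<Gamma> :: "(nat \<Rightarrow> int) set"
  assumes "n \<ge> 1" and "\<Gamma> \<in> AN n"
  shows "dual_AN n (reverse_op n \<Gamma>) = inv_into (AN n) (reverse_op n) (dual_AN n \<Gamma>)"
  using reverse_op_bij[of n] reverse_dual_reverse[OF assms(2)] dual_AN_AN[OF reverse_op_AN[OF assms(2)]]
  \<comment> \<open>The dual of the image of \<Gamma> is an antichain that
    \<open>reverse_op n\<close> sends to \<open>dual_AN n \<Gamma>\<close>; injectivity makes it the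
    value of the inverse there.\<close>
  by (metis bij_betw_def inv_into_f_f)

end
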